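(* Let $k$ be a field of characteristic different from two and let $L$ be a nonabelian nilpotent Lie $k$-algebra with a $k$-involution $*\colon L\to L$. Then $L$ contains a $*$-invariant Heisenberg Lie $k$-subalgebra $H$ such that, for suitable generators $x,y$ of $H$ and $z=[y,x]$, the restriction of $*$ to $H$ is one of the three involutions $(x,y,z)\mapsto(x,-y,z)$, $(x,y,z)\mapsto(x,y,-z)$, $(x,y,z)\mapsto(-x,-y,-z)$. More precisely, there exist $x,y\in L$ such that $[y,x]\neq 0$, $[y,[y,x]]=[x,[y,x]]=0$, and either $x^*=x,\ y^*=-y$, or $x^*=x,\ y^*=y$, or $x^*=-x,\ y^*=-y$.
   Context: A $k$-involution of a Lie $k$-algebra $L$ is a $k$-linear map $*\colon L\to L$ such that $[a,b]^*=[b^*,a^*]$ and $a^{**}=a$ for all $a,b\in L$. The Heisenberg Lie $k$-algebra is $\langle x,y\mid [x,[y,x]]=[y,[y,x]]=0\rangle$; it has $k$-basis $x,y,z=[y,x]$ with $z$ central. *)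

theory Defs
  imports Complex_Main
begin

section \<open>Lie algebras over a field\<close>

locale lie_algebra = vector_space scale
  for scale :: "'k::field \<Rightarrow> 'a::ab_group_add \<Rightarrow> 'a" (infixr \<open>*s\<close> 75) +
  fixes bracket :: "'a \<Rightarrow> 'a \<Rightarrow> 'a"
  assumes bracket_add_left: "bracket (a + b) c = bracket a c + bracket b c"
    and bracket_add_right: "bracket a (b + c) = bracket a b + bracket a c"
    and bracket_scale_left: "bracket (r *s a) b = r *s bracket a b"
    and bracket_scale_right: "bracket a (r *s b) = r *s bracket a b"
    and bracket_self: "bracket a a = 0"
    and jacobi: "bracket a (bracket b c) + bracket b (bracket c a) + bracket c (bracket a b) = 0"
begin

definition abelian :: bool where
  "abelian \<longleftrightarrow> (\<forall>a b. bracket a b = 0)"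

fun lower_central :: "nat \<Rightarrow> 'a set" where
  "lower_central 0 = UNIV"
| "lower_central (Suc n) = span {bracket a b |a b. b \<in> lower_central n}"

definition nilpotent :: bool where
  "nilpotent \<longleftrightarrow> (\<exists>n. lower_central n = {0})"

definition lie_subalgebra :: "'a set \<Rightarrow> bool" where
  "lie_subalgebra H \<longleftrightarrow> subspace H \<and> (\<forall>a\<in>H. \<forall>b\<in>H. bracket a b \<in> H)"

definition lie_involution :: "('a \<Rightarrow> 'a) \<Rightarrow> bool" where
  "lie_involution star \<longleftrightarrow>
     Vector_Spaces.linear scale scale star \<and>
     (\<forall>a b. star (bracket a b) = bracket (star b) (star a)) \<and>
     (\<forall>a. star (star a) = a)"

end


section \<open>Presentations by generators and relations\<close>

datatype ('k, 'g) lie_term =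
    Gen 'g
  | Zero
  | Plus "('k, 'g) lie_term" "('k, 'g) lie_term"
  | Scale 'k "('k, 'g) lie_term"
  | Brack "('k, 'g) lie_term" "('k, 'g) lie_term"

text \<open>
  \<open>lie_eq R\<close> is the least congruence on terms that contains the relations \<open>R\<close> and the identities
  of Lie algebras. The set of terms modulo \<open>lie_eq R\<close> is thus the Lie algebra with generators
  \<open>'g\<close> and relations \<open>R\<close>, i.e. the free Lie algebra on \<open>'g\<close> modulo the ideal generated by \<open>R\<close>.
\<close>

inductive lie_eq ::
  "(('k::field, 'g) lie_term \<times> ('k, 'g) lie_term) set \<Rightarrow>
   ('k, 'g) lie_term \<Rightarrow> ('k, 'g) lie_term \<Rightarrow> bool"
  for R where
  rel: "(s, t) \<in> R \<Longrightarrow> lie_eq R s t"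
| refl: "lie_eq R s s"
| sym: "lie_eq R s t \<Longrightarrow> lie_eq R t s"
| trans: "lie_eq R s t \<Longrightarrow> lie_eq R t u \<Longrightarrow> lie_eq R s u"
| cong_Plus: "lie_eq R s s' \<Longrightarrow> lie_eq R t t' \<Longrightarrow> lie_eq R (Plus s t) (Plus s' t')"
| cong_Scale: "lie_eq R s s' \<Longrightarrow> lie_eq R (Scale r s) (Scale r s')"
| cong_Brack: "lie_eq R s s' \<Longrightarrow> lie_eq R t t' \<Longrightarrow> lie_eq R (Brack s t) (Brack s' t')"
| Plus_assoc: "lie_eq R (Plus (Plus s t) u) (Plus s (Plus t u))"
| Plus_commute: "lie_eq R (Plus s t) (Plus t s)"
| Plus_Zero: "lie_eq R (Plus s Zero) s"
| Plus_inverse: "lie_eq R (Plus s (Scale (- 1) s)) Zero"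
| Scale_Plus: "lie_eq R (Scale r (Plus s t)) (Plus (Scale r s) (Scale r t))"
| Scale_add: "lie_eq R (Scale (q + r) s) (Plus (Scale q s) (Scale r s))"
| Scale_Scale: "lie_eq R (Scale q (Scale r s)) (Scale (q * r) s)"
| Scale_one: "lie_eq R (Scale 1 s) s"
| Brack_Plus_left: "lie_eq R (Brack (Plus s t) u) (Plus (Brack s u) (Brack t u))"
| Brack_Plus_right: "lie_eq R (Brack s (Plus t u)) (Plus (Brack s t) (Brack s u))"
| Brack_Scale_left: "lie_eq R (Brack (Scale r s) t) (Scale r (Brack s t))"
| Brack_Scale_right: "lie_eq R (Brack s (Scale r t)) (Scale r (Brack s t))"
| Brack_self: "lie_eq R (Brack s s) Zero"
| Jacobi: "lie_eq R (Plus (Plus (Brack s (Brack t u)) (Brack t (Brack u s)))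
                        (Brack u (Brack s t))) Zero"

context lie_algebra
begin

primrec lie_eval :: "('g \<Rightarrow> 'a) \<Rightarrow> ('k, 'g) lie_term \<Rightarrow> 'a" where
  "lie_eval g (Gen i) = g i"
| "lie_eval g Zero = 0"
| "lie_eval g (Plus s t) = lie_eval g s + lie_eval g t"
| "lie_eval g (Scale r t) = r *s lie_eval g t"
| "lie_eval g (Brack s t) = bracket (lie_eval g s) (lie_eval g t)"

text \<open>
  The elements \<open>g i\<close> generate the subalgebra \<open>H\<close>, and the canonical map from the Lie algebra
  presented by \<open>R\<close> onto \<open>H\<close> is well defined and injective; so \<open>H\<close> has the presentation \<open>R\<close> in
  the generators \<open>g i\<close>.
\<close>

definition presented_by ::
  "'a set \<Rightarrow> ('g \<Rightarrow> 'a) \<Rightarrow> (('k, 'g) lie_term \<times> ('k, 'g) lie_term) set \<Rightarrow> bool" where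
  "presented_by H g R \<longleftrightarrow>
     H = lie_subalgebra hull (range g) \<and>
     (\<forall>s t. lie_eval g s = lie_eval g t \<longleftrightarrow> lie_eq R s t)"

end


section \<open>The Heisenberg Lie algebra\<close>

datatype heisenberg_gen = Gen_x | Gen_y

definition heisenberg_relations ::
  "(('k, heisenberg_gen) lie_term \<times> ('k, heisenberg_gen) lie_term) set" where
  "heisenberg_relations =
     {(Brack (Gen Gen_x) (Brack (Gen Gen_y) (Gen Gen_x)), Zero),
      (Brack (Gen Gen_y) (Brack (Gen Gen_y) (Gen Gen_x)), Zero)}"

context lie_algebra
begin

definition heisenberg_subalgebra :: "'a set \<Rightarrow> 'a \<Rightarrow> 'a \<Rightarrow> bool" where
  "heisenberg_subalgebra H x y \<longleftrightarrow>
     lie_subalgebra H \<and>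
     presented_by H (case_heisenberg_gen x y) heisenberg_relations"

end

end

theory Submission
  imports Defs
begin

text \<open>
  The elements \<open>x\<close> with \<open>[b, [a, x]] = 0\<close> for all \<open>a, b\<close> (the second centre) form a
  \<open>*\<close>-invariant subspace, and by nilpotency some such \<open>x\<close> is not central. In characteristic
  different from two, \<open>L\<close> is the sum of its symmetric and its skew elements, so one of the two
  components of \<open>x\<close>, which again lies in the second centre, has a nonzero bracket with a
  symmetric or a skew element \<open>y\<close>. The bracket of \<open>y\<close> and \<open>x\<close> is central, hence \<open>x\<close> and \<open>y\<close>
  generate a Heisenberg algebra.
\<close>

section \<open>The presentation of the Heisenberg algebra\<close>

text \<open>Coordinates with respect to \<open>x\<close>, \<open>y\<close> and \<open>[y, x]\<close>.\<close>

primrec heisenberg_coords :: "('k::field, heisenberg_gen) lie_term \<Rightarrow> 'k \<times> 'k \<times> 'k" where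
  "heisenberg_coords (Gen i) = (case i of Gen_x \<Rightarrow> (1, 0, 0) | Gen_y \<Rightarrow> (0, 1, 0))"
| "heisenberg_coords Zero = (0, 0, 0)"
| "heisenberg_coords (Plus s t) =
    (case (heisenberg_coords s, heisenberg_coords t) of
      ((a, b, c), (a', b', c')) \<Rightarrow> (a + a', b + b', c + c'))"
| "heisenberg_coords (Scale r t) =
    (case heisenberg_coords t of (a, b, c) \<Rightarrow> (r * a, r * b, r * c))"
| "heisenberg_coords (Brack s t) =
    (case (heisenberg_coords s, heisenberg_coords t) of
      ((a, b, c), (a', b', c')) \<Rightarrow> (0, 0, b * a' - a * b'))"

section \<open>Bracket identities and the evaluation of terms\<close>

context lie_algebra
begin

lemma bracket_zero_left [simp]: "bracket 0 a = 0"
  using bracket_add_left[of 0 0 a] by simp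

lemma bracket_zero_right [simp]: "bracket a 0 = 0"
  using bracket_add_right[of a 0 0] by simp

lemma bracket_anticommute: "bracket a b = - bracket b a"
proof -
  have "bracket (a + b) (a + b) = (bracket a a + bracket a b) + (bracket b a + bracket b b)"
    by (simp only: bracket_add_left bracket_add_right add_ac)
  then show ?thesis
    by (simp add: bracket_self eq_neg_iff_add_eq_0)
qed

lemma bracket_minus_left: "bracket (- a) b = - bracket a b"
  using bracket_add_left[of "- a" a b] by (simp add: eq_neg_iff_add_eq_0)

lemma bracket_minus_right: "bracket a (- b) = - bracket a b"
  using bracket_add_right[of a "- b" b] by (simp add: eq_neg_iff_add_eq_0)

text \<open>By the two relations \<open>bracket y x\<close> commutes with \<open>x\<close> and
  \<open>y\<close>, so a bracket of two combinations collapses to a multiple of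
  \<open>bracket y x\<close>. Being stated for an arbitrary Lie algebra, this applies both to the
  given algebra and to the presented one.\<close>

lemma lie_eval_heisenberg_coords:
  assumes "bracket x (bracket y x) = 0" and "bracket y (bracket y x) = 0"
  shows "lie_eval (case_heisenberg_gen x y) t =
    (case heisenberg_coords t of (a, b, c) \<Rightarrow> a *s x + b *s y + c *s bracket y x)"
proof (induction t)
  case (Gen i)
  show ?case by (cases i) simp_all
next
  case Zero
  show ?case by simp
next
  case (Plus s t)
  then show ?case by (auto simp: scale_left_distrib split: prod.splits)
next
  case (Scale r t)
  then show ?case by (auto simp: scale_right_distrib split: prod.splits)
next
  case (Brack s t)
  have "bracket (bracket y x) x = 0" "bracket (bracket y x) y = 0"
    using assms bracket_anticommute[of "bracket y x"] by simp_all
  with Brack assms bracket_anticommute[of x y] show ?case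
    by (auto simp: bracket_add_left bracket_add_right bracket_scale_left bracket_scale_right
        bracket_self scale_left_diff_distrib mult.commute split: prod.splits)
qed

text \<open>Soundness of \<open>lie_eq\<close>: each of its rules other than \<open>rel\<close> is
  valid in every Lie algebra.\<close>

lemma lie_eval_cong:
  assumes "lie_eq R s t"
    and "\<And>u v. (u, v) \<in> R \<Longrightarrow> lie_eval g u = lie_eval g v"
  shows "lie_eval g s = lie_eval g t"
  using assms(1)
proof (induction rule: lie_eq.induct)
  case (Jacobi s t u)
  show ?case by (simp add: jacobi)
qed (simp_all add: assms(2) add.commute add.assoc scale_right_distrib scale_left_distrib
    bracket_add_left bracket_add_right bracket_scale_left bracket_scale_right bracket_self)

end

\<comment> \<open>The Lie algebra presented by the Heisenberg relations\<close>
quotient_type (overloaded) 'k heisenberg = "('k::field, heisenberg_gen) lie_term" / "lie_eq heisenberg_relations"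
proof (rule equivpI)
  show "reflp (lie_eq (heisenberg_relations :: (('k, heisenberg_gen) lie_term \<times> _) set))"
    by (simp add: reflpI lie_eq.refl)
  show "symp (lie_eq (heisenberg_relations :: (('k, heisenberg_gen) lie_term \<times> _) set))"
    by (simp add: sympI lie_eq.sym)
  show "transp (lie_eq (heisenberg_relations :: (('k, heisenberg_gen) lie_term \<times> _) set))"
    by (rule transpI) (rule lie_eq.trans)
qed

instantiation heisenberg :: (field) ab_group_add
begin

lift_definition zero_heisenberg :: "'a heisenberg" is Zero .

lift_definition plus_heisenberg :: "'a heisenberg \<Rightarrow> 'a heisenberg \<Rightarrow> 'a heisenberg" is Plus
  by (rule lie_eq.cong_Plus)

lift_definition uminus_heisenberg :: "'a heisenberg \<Rightarrow> 'a heisenberg" is "Scale (- 1)"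
  by (rule lie_eq.cong_Scale)

definition minus_heisenberg :: "'a heisenberg \<Rightarrow> 'a heisenberg \<Rightarrow> 'a heisenberg" where
  "minus_heisenberg a b = a + - b"

instance
proof
  fix a b c :: "'a heisenberg"
  show "a + b + c = a + (b + c)"
    by transfer (rule lie_eq.Plus_assoc)
  show commute: "a + b = b + a" for a b :: "'a heisenberg"
    by transfer (rule lie_eq.Plus_commute)
  have "a + 0 = a"
    by transfer (rule lie_eq.Plus_Zero)
  then show "0 + a = a"
    by (simp add: commute)
  have "a + - a = 0"
    by transfer (rule lie_eq.Plus_inverse)
  then show "- a + a = 0"
    by (simp add: commute)
  show "a - b = a + - b"
    by (rule minus_heisenberg_def)
qed

end

lift_definition heisenberg_scale :: "'k::field \<Rightarrow> 'k heisenberg \<Rightarrow> 'k heisenberg" is Scale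
  by (rule lie_eq.cong_Scale)

lift_definition heisenberg_bracket ::
  "'k::field heisenberg \<Rightarrow> 'k heisenberg \<Rightarrow> 'k heisenberg" is Brack
  by (rule lie_eq.cong_Brack)

lift_definition heisenberg_gen :: "heisenberg_gen \<Rightarrow> 'k::field heisenberg" is Gen .

text \<open>With this, normal forms modulo \<open>lie_eq\<close> come from a computation in a Lie
  algebra instead of from explicit derivations.\<close>

interpretation heisenberg: lie_algebra
  "heisenberg_scale :: 'k::field \<Rightarrow> _" "heisenberg_bracket :: 'k heisenberg \<Rightarrow> _"
  by (unfold_locales; transfer)
    (rule lie_eq.Scale_Plus lie_eq.Scale_add lie_eq.Scale_Scale lie_eq.Scale_one
      lie_eq.Brack_Plus_left lie_eq.Brack_Plus_right lie_eq.Brack_Scale_left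
      lie_eq.Brack_Scale_right lie_eq.Brack_self lie_eq.Jacobi)+

lemma heisenberg_eval_gen:
  "heisenberg.lie_eval heisenberg_gen t = abs_heisenberg t"
  by (induction t)
    (simp_all add: heisenberg_gen.abs_eq zero_heisenberg.abs_eq plus_heisenberg.abs_eq
      heisenberg_scale.abs_eq heisenberg_bracket.abs_eq)

text \<open>The generators of the quotient satisfy the relations, so the class of a term is the
  linear combination given by its coordinates; equality of classes is \<open>lie_eq\<close>.\<close>

lemma lie_eq_if_heisenberg_coords_eq:
  fixes s t :: "('k::field, heisenberg_gen) lie_term"
  assumes "heisenberg_coords s = heisenberg_coords t"
  shows "lie_eq heisenberg_relations s t"
proof -
  let ?x = "heisenberg_gen Gen_x :: 'k heisenberg" and ?y = "heisenberg_gen Gen_y :: 'k heisenberg"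
  have gen: "heisenberg_gen = case_heisenberg_gen ?x ?y"
    by (rule ext) (simp split: heisenberg_gen.split)
  have "heisenberg_bracket ?x (heisenberg_bracket ?y ?x) = 0"
    by transfer (rule lie_eq.rel, simp add: heisenberg_relations_def)
  moreover have "heisenberg_bracket ?y (heisenberg_bracket ?y ?x) = 0"
    by transfer (rule lie_eq.rel, simp add: heisenberg_relations_def)
  ultimately have "abs_heisenberg s = abs_heisenberg t"
    using assms heisenberg.lie_eval_heisenberg_coords[of ?x ?y]
    unfolding heisenberg_eval_gen[symmetric] by (subst (1 2) gen) simp
  then show ?thesis
    by (simp add: heisenberg.abs_eq_iff)
qed

section \<open>Heisenberg subalgebras generated by two elements\<close>

context lie_algebra
begin

lemma lie_subalgebra_hull: "lie_subalgebra (lie_subalgebra hull S)"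
  by (rule hull_in) (auto simp: lie_subalgebra_def subspace_def)

text \<open>The canonical map is injective because \<open>x\<close>, \<open>y\<close> and
  \<open>bracket y x\<close> are linearly independent: a value determines the coordinates, and these
  determine the term modulo \<open>lie_eq\<close>.\<close>

lemma heisenberg_subalgebra_hull:
  assumes xz: "bracket x (bracket y x) = 0" and yz: "bracket y (bracket y x) = 0"
    and nz: "bracket y x \<noteq> 0"
  shows "heisenberg_subalgebra (lie_subalgebra hull {x, y}) x y"
proof -
  let ?g = "case_heisenberg_gen x y" and ?z = "bracket y x"
  have "UNIV = {Gen_x, Gen_y}"
    using heisenberg_gen.exhaust by auto
  then have "range ?g = ?g ` {Gen_x, Gen_y}"
    by (rule arg_cong)
  then have range: "range ?g = {x, y}"
    by simp
  have sound: "lie_eval ?g s = lie_eval ?g t" if "lie_eq heisenberg_relations s t" for s t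
    using that by (rule lie_eval_cong) (auto simp: heisenberg_relations_def xz yz)
  have complete: "lie_eq heisenberg_relations s t" if eq: "lie_eval ?g s = lie_eval ?g t" for s t
  proof -
    obtain a b c a' b' c' where
      s: "heisenberg_coords s = (a, b, c)" and t: "heisenberg_coords t = (a', b', c')"
      by (metis prod_cases3)
    have eq: "a *s x + b *s y + c *s ?z = a' *s x + b' *s y + c' *s ?z"
      using eq s t by (simp add: lie_eval_heisenberg_coords[OF xz yz])
    \<comment> \<open>Bracketing with \<open>y\<close> leaves only \<open>a *s ?z\<close>;
      bracketing with \<open>x\<close> below leaves only \<open>- (b *s ?z)\<close>.\<close>
    have "bracket y (a *s x + b *s y + c *s ?z) = bracket y (a' *s x + b' *s y + c' *s ?z)"
      using eq by simp
    then have "a = a'"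
      using nz by (simp add: bracket_add_right bracket_scale_right bracket_self yz)
    have "bracket x (a *s x + b *s y + c *s ?z) = bracket x (a' *s x + b' *s y + c' *s ?z)"
      using eq by simp
    then have "b = b'"
      using nz bracket_anticommute[of x y]
      by (simp add: bracket_add_right bracket_scale_right bracket_self xz)
    have "c = c'"
      using eq nz \<open>a = a'\<close> \<open>b = b'\<close> by simp
    with \<open>a = a'\<close> \<open>b = b'\<close> s t show ?thesis
      by (intro lie_eq_if_heisenberg_coords_eq) simp
  qed
  show ?thesis
    unfolding heisenberg_subalgebra_def presented_by_def range
    by (intro conjI allI iffI lie_subalgebra_hull HOL.refl) (erule complete, erule sound)
qed

section \<open>Involutions\<close>

text \<open>The preimage of the hull under \<open>star\<close> is again a subalgebra, since
  reversing the factors of a bracket does not matter for closure.\<close>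

lemma lie_involution_hull_subset:
  assumes "lie_involution star" and "star ` S \<subseteq> lie_subalgebra hull S"
  shows "star ` (lie_subalgebra hull S) \<subseteq> lie_subalgebra hull S"
proof -
  let ?H = "lie_subalgebra hull S"
  interpret star: Vector_Spaces.linear scale scale star
    using assms(1) by (simp add: lie_involution_def)
  have br: "star (bracket a b) = bracket (star b) (star a)" for a b
    using assms(1) by (simp add: lie_involution_def)
  have H: "subspace ?H" "\<And>a b. a \<in> ?H \<Longrightarrow> b \<in> ?H \<Longrightarrow> bracket a b \<in> ?H"
    using lie_subalgebra_hull[of S] by (auto simp: lie_subalgebra_def)
  have "lie_subalgebra (star -` ?H)"
    unfolding lie_subalgebra_def[of "star -` ?H"] subspace_def[of "star -` ?H"] using H
    by (auto simp: br star.add star.scale star.zero subspace_0 subspace_add subspace_scale)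
  moreover have "S \<subseteq> star -` ?H"
    using assms(2) by auto
  ultimately have "?H \<subseteq> star -` ?H"
    by (intro hull_minimal)
  then show ?thesis
    by auto
qed

text \<open>Take \<open>x\<close> two steps before the lower central series first vanishes: two
  brackets kill that term, but one does not.\<close>

lemma nilpotent_second_center_not_central:
  assumes "nilpotent" and "\<not> abelian"
  obtains a x where "bracket a x \<noteq> 0" and "\<And>b c. bracket b (bracket c x) = 0"
proof -
  define n where "n = (LEAST n. lower_central n = {0})"
  have n: "lower_central n = {0}"
    using assms(1) unfolding nilpotent_def n_def by (rule LeastI_ex)
  have least: "lower_central m \<noteq> {0}" if "m < n" for m
    using that not_less_Least unfolding n_def by blast
  obtain p q where pq: "bracket p q \<noteq> 0"
    using assms(2) by (auto simp: abelian_def)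
  have mem: "bracket a b \<in> lower_central (Suc m)" if "b \<in> lower_central m" for a b m
    using that by (auto intro: span_base)
  \<comment> \<open>The series starts at index 0 with the whole algebra, so the nonzero
    \<open>bracket p q\<close> lies in its terms 0 and 1, which forces \<open>n\<close> to be at
    least 2.\<close>
  have "n \<noteq> 0"
    using n pq by (metis UNIV_I lower_central.simps(1) singletonD)
  moreover have "n \<noteq> Suc 0"
  proof
    assume "n = Suc 0"
    moreover have "bracket p q \<in> lower_central (Suc 0)"
      by (rule mem) simp
    ultimately show False
      using n pq by (metis singletonD)
  qed
  ultimately obtain m where m: "n = Suc (Suc m)"
    by (metis not0_implies_Suc)
  have "\<exists>a x. x \<in> lower_central m \<and> bracket a x \<noteq> 0"
  proof (rule ccontr)
    assume "\<not> ?thesis"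
    then have "{bracket a b |a b. b \<in> lower_central m} \<subseteq> {0}"
      by auto
    then have "span {bracket a b |a b. b \<in> lower_central m} \<subseteq> span {0}"
      by (rule span_mono)
    then have "lower_central (Suc m) = {0}"
      using span_zero by auto
    with least[of "Suc m"] m show False
      by simp
  qed
  then obtain a x where x: "x \<in> lower_central m" and ax: "bracket a x \<noteq> 0"
    by blast
  have "bracket b (bracket c x) = 0" for b c
    using mem[OF mem[OF x], of b c] n m by (metis singletonD)
  with ax show thesis
    by (rule that)
qed

text \<open>The explicit formulas for \<open>s\<close> and \<open>k\<close> are exported so that any
  subspace containing \<open>a\<close> and \<open>star a\<close> is seen to contain both
  components.\<close>

lemma lie_involution_decomp:
  assumes "(2 :: 'k) \<noteq> 0" and "lie_involution star"
  obtains s k where "a = s + k" and "star s = s" and "star k = - k"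
    and "s = (1 / 2) *s (a + star a)" and "k = (1 / 2) *s (a - star a)"
proof -
  interpret star: Vector_Spaces.linear scale scale star
    using assms(2) by (simp add: lie_involution_def)
  have invol: "star (star b) = b" for b
    using assms(2) by (simp add: lie_involution_def)
  have half: "(1 / 2 :: 'k) + 1 / 2 = 1"
    using assms(1) by (simp add: field_simps)
  show thesis
  proof (rule that)
    have "(1 / 2) *s (a + star a) + (1 / 2) *s (a - star a) = (1 / 2 + 1 / 2) *s a"
      by (simp only: scale_left_distrib scale_right_distrib scale_right_diff_distrib) simp
    then show "a = (1 / 2) *s (a + star a) + (1 / 2) *s (a - star a)"
      by (simp only: half scale_one)
    show "star ((1 / 2) *s (a + star a)) = (1 / 2) *s (a + star a)"
      by (simp add: star.scale star.add invol add.commute)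
    show "star ((1 / 2) *s (a - star a)) = - ((1 / 2) *s (a - star a))"
      by (simp add: star.scale star.diff invol scale_right_diff_distrib)
  qed simp_all
qed

lemma exists_homogeneous_heisenberg_pair:
  assumes two: "(2 :: 'k) \<noteq> 0" and "nilpotent" and "\<not> abelian"
    and invol: "lie_involution star"
  obtains x y where "bracket y x \<noteq> 0" and "\<And>b. bracket b (bracket y x) = 0"
    and "star x = x \<or> star x = - x" and "star y = y \<or> star y = - y"
proof -
  obtain a x where ax: "bracket a x \<noteq> 0" and x: "\<And>b c. bracket b (bracket c x) = 0"
    by (rule nilpotent_second_center_not_central[OF assms(2,3)]) blast
  interpret star: Vector_Spaces.linear scale scale star
    using invol by (simp add: lie_involution_def)
  have br: "star (bracket b c) = bracket (star c) (star b)"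
    and ss: "star (star b) = b" for b c
    using invol by (simp_all add: lie_involution_def)
  \<comment> \<open>Applying \<open>star\<close> reverses the nested bracket; anticommuting twice
    restores its order without a sign, so the assumption on \<open>x\<close> applies to
    \<open>star b\<close> and \<open>star c\<close>.\<close>
  have star_x: "bracket b (bracket c (star x)) = 0" for b c
  proof -
    have "bracket b (bracket c (star x)) = star (bracket (bracket x (star c)) (star b))"
      by (simp add: br ss)
    also have "bracket (bracket x (star c)) (star b) = bracket (star b) (bracket (star c) x)"
      by (simp add: bracket_anticommute[of x "star c"] bracket_minus_left
          bracket_anticommute[of "bracket (star c) x" "star b"])
    finally show ?thesis
      by (simp add: x star.zero)
  qed
  have diff: "bracket b (c - d) = bracket b c - bracket b d" for b c d
    using bracket_add_right[of b c "- d"] by (simp add: bracket_minus_right)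
  obtain u v where uv: "x = u + v" "star u = u" "star v = - v"
    and u: "u = (1 / 2) *s (x + star x)" and v: "v = (1 / 2) *s (x - star x)"
    by (rule lie_involution_decomp[OF two invol])
  have "bracket b (bracket c u) = 0" "bracket b (bracket c v) = 0" for b c
    unfolding u v by (simp_all add: bracket_scale_right bracket_add_right diff x star_x)
  moreover have "bracket a u \<noteq> 0 \<or> bracket a v \<noteq> 0"
    using ax uv(1) by (auto simp: bracket_add_right)
  ultimately obtain w where w: "bracket a w \<noteq> 0" "\<And>b c. bracket b (bracket c w) = 0"
    "star w = w \<or> star w = - w"
    using uv(2,3) by metis
  \<comment> \<open>Since \<open>bracket c w\<close> is central for every \<open>c\<close>, either
    component of \<open>a\<close> may serve as \<open>y\<close>.\<close>
  obtain s k where sk: "a = s + k" "star s = s" "star k = - k"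
    by (rule lie_involution_decomp[OF two invol])
  have "bracket s w \<noteq> 0 \<or> bracket k w \<noteq> 0"
    using w(1) sk(1) by (auto simp: bracket_add_left)
  then obtain y where "bracket y w \<noteq> 0" "star y = y \<or> star y = - y"
    using sk(2,3) by metis
  then show thesis
    using that[of y w] w by blast
qed

end

theorem proposition3p4:
  fixes scale :: "'k::field \<Rightarrow> 'a::ab_group_add \<Rightarrow> 'a"
    and br :: "'a \<Rightarrow> 'a \<Rightarrow> 'a"
    and star :: "'a \<Rightarrow> 'a"
  assumes "CHAR('k) \<noteq> 2"
    and "lie_algebra scale br"
    and "\<not> lie_algebra.abelian br"
    and "lie_algebra.nilpotent scale br"
    and "lie_algebra.lie_involution scale br star"
  shows "\<exists>H x y z.
           lie_algebra.heisenberg_subalgebra scale br H x y \<and>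
           star ` H \<subseteq> H \<and>
           z = br y x \<and> z \<noteq> 0 \<and> br y z = 0 \<and> br x z = 0 \<and>
           ((star x = x \<and> star y = - y \<and> star z = z) \<or>
            (star x = x \<and> star y = y \<and> star z = - z) \<or>
            (star x = - x \<and> star y = - y \<and> star z = - z))"
proof -
  interpret lie_algebra scale br
    by (rule assms(2))
  have two: "(2 :: 'k) \<noteq> 0"
  proof
    assume "(2 :: 'k) = 0"
    then have "of_nat 2 = (0 :: 'k)"
      by simp
    \<comment> \<open>A nonzero divisor of 2 is 1 or 2, and a field does not have characteristic
      1.\<close>
    then have "CHAR('k) dvd 2"
      by (simp only: of_nat_eq_0_iff_char_dvd)
    then have "CHAR('k) \<le> 2" "CHAR('k) \<noteq> 0"
      by (auto intro: dvd_imp_le intro!: gr0I)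
    then show False
      using assms(1) CHAR_not_1'[where ?'a = 'k] by linarith
  qed
  have anti: "star (br a b) = br (star b) (star a)" for a b
    using assms(5) by (simp add: lie_involution_def)
  have "\<exists>x y. br y x \<noteq> 0 \<and> (\<forall>b. br b (br y x) = 0) \<and>
      ((star x = x \<and> star y = - y) \<or> (star x = x \<and> star y = y) \<or> (star x = - x \<and> star y = - y))"
  proof -
    obtain x y where xy: "br y x \<noteq> 0" "\<And>b. br b (br y x) = 0"
      "star x = x \<or> star x = - x" "star y = y \<or> star y = - y"
      by (rule exists_homogeneous_heisenberg_pair[OF two assms(4,3,5)]) blast
    \<comment> \<open>Of the four sign patterns only \<open>x\<close> skew with \<open>y\<close>
      symmetric is not listed; exchanging \<open>x\<close> and \<open>y\<close> reduces it to the
      first one.\<close>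
    have "br x y \<noteq> 0" "\<And>b. br b (br x y) = 0"
      using xy(1,2) bracket_anticommute[of x y] by (simp_all add: bracket_minus_right)
    with xy show ?thesis
      by metis
  qed
  then obtain x y where nz: "br y x \<noteq> 0" and z: "\<And>b. br b (br y x) = 0"
    and cases: "(star x = x \<and> star y = - y) \<or> (star x = x \<and> star y = y) \<or>
      (star x = - x \<and> star y = - y)"
    by blast
  let ?H = "lie_subalgebra hull {x, y}"
  have "x \<in> ?H" "y \<in> ?H" "subspace ?H"
    using lie_subalgebra_hull[of "{x, y}"] by (auto simp: lie_subalgebra_def intro: hull_inc)
  then have "star ` {x, y} \<subseteq> ?H"
    using cases by (auto simp: subspace_neg)
  then have "star ` ?H \<subseteq> ?H"
    by (rule lie_involution_hull_subset[OF assms(5)])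
  moreover have "heisenberg_subalgebra ?H x y"
    by (rule heisenberg_subalgebra_hull[OF z z nz])
  \<comment> \<open>The reversal in \<open>star (br y x) = br (star x) (star y)\<close> contributes
    a sign, so \<open>br y x\<close> is fixed for opposite signs of \<open>x\<close> and
    \<open>y\<close> and negated for equal ones.\<close>
  moreover have "(star x = x \<and> star y = - y \<and> star (br y x) = br y x) \<or>
      (star x = x \<and> star y = y \<and> star (br y x) = - br y x) \<or>
      (star x = - x \<and> star y = - y \<and> star (br y x) = - br y x)"
    using cases bracket_anticommute[of x y]
    by (auto simp: anti bracket_minus_left bracket_minus_right)
  ultimately show ?thesis
    using nz z by blast
qed

end
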